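(* Let $X$ be a finite dimensional normed space, $A\subset X$ be a closed set, $\varphi$ be lower semicontinuous on $A$, and $f$ be lower semicontinuous at every point of $\Omega$. Suppose also that one of the following conditions is satisfied: (1) the set $\{x\in A\mid F_\mu(x)<f^*\}$ is bounded for some $\mu\ge0$; (2) the set $\Omega_\delta=\{x\in A\mid\varphi(x)<\delta\}$ is bounded for some $\delta>0$. Then for the penalty function $F_\lambda=f+\lambda\varphi$ to be (globally) exact it is necessary and sufficient that $F_\lambda$ is exact at every globally optimal solution of the problem $(\mathcal{P})$: $\min f(x)$ subject to $x\in M$, $x\in A$, and that $F_{\lambda_0}$ is bounded below on $A$ for some $\lambda_0\ge0$.
   Context: $M,A\subset X$ are nonempty, $f\colon X\to\mathbb{R}\cup\{+\infty\}$, $\varphi\colon X\to[0,+\infty)$ with $M=\{x\in X\mid\varphi(x)=0\}$, $\Omega=M\cap A$, $f^*=\inf_{x\in\Omega}f(x)$, $F_\lambda(x)=f(x)+\lambda\varphi(x)$ for $\lambda\ge0$. Standing assumptions: $f(x)<+\infty$ for some $x\in\Omega$, and $f$ attains a global minimum on $\Omega$. $F_\lambda$ is (globally) exact if there exists $\lambda_0\ge0$ such that for every $\lambda>\lambda_0$ the set of global minimizers of $F_\lambda$ on $A$ coincides with the set of globally optimal solutions of $(\mathcal{P})$. It is exact at a point $x^*$ (a locally, in particular globally, optimal solution of $(\mathcal{P})$) if there exists $\lambda^*\ge0$ such that $x^*$ is a point of local minimum of $F_{\lambda^*}$ on $A$. Lower semicontinuity of $f$ at a point of $\Omega$ is that of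 $f$ as a function on $X$ (not merely of its restriction to $\Omega$). *)

theory Defs
  imports "HOL-Analysis.Analysis"
begin

(* Lower semicontinuity of the restriction of g to S at x (for x in S).  The filter "at x within S"
   omits x itself, which is harmless because y < g x.  S = UNIV gives the notion on the whole space. *)
definition lsc_at_within ::
  "('a::topological_space \<Rightarrow> 'b::linorder) \<Rightarrow> 'a \<Rightarrow> 'a set \<Rightarrow> bool" where
  "lsc_at_within g x S \<longleftrightarrow> (\<forall>y<g x. \<forall>\<^sub>F z in at x within S. y < g z)"

definition lsc_on :: "'a::topological_space set \<Rightarrow> ('a \<Rightarrow> 'b::linorder) \<Rightarrow> bool" where
  "lsc_on S g \<longleftrightarrow> (\<forall>x\<in>S. lsc_at_within g x S)"

definition global_minimizers :: "('a \<Rightarrow> 'b::linorder) \<Rightarrow> 'a set \<Rightarrow> 'a set" where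
  "global_minimizers g S = {x. is_arg_min g (\<lambda>z. z \<in> S) x}"

definition local_min_on ::
  "('a::topological_space \<Rightarrow> 'b::linorder) \<Rightarrow> 'a set \<Rightarrow> 'a \<Rightarrow> bool" where
  "local_min_on g S x \<longleftrightarrow> x \<in> S \<and> (\<forall>\<^sub>F z in at x within S. g x \<le> g z)"

definition penalty :: "('a \<Rightarrow> ereal) \<Rightarrow> ('a \<Rightarrow> real) \<Rightarrow> real \<Rightarrow> 'a \<Rightarrow> ereal" where
  "penalty f \<phi> l x = f x + ereal (l * \<phi> x)"

(* The constraint set M is the zero set of \<phi> in all uses; it is passed explicitly because the
   problem "minimise f over M \<inter> A" is stated in terms of M. *)
definition globally_exact ::
  "('a \<Rightarrow> ereal) \<Rightarrow> ('a \<Rightarrow> real) \<Rightarrow> 'a set \<Rightarrow> 'a set \<Rightarrow> bool" where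
  "globally_exact f \<phi> M A \<longleftrightarrow>
     (\<exists>l0\<ge>0. \<forall>l>l0. global_minimizers (penalty f \<phi> l) A = global_minimizers f (M \<inter> A))"

definition exact_at ::
  "('a::topological_space \<Rightarrow> ereal) \<Rightarrow> ('a \<Rightarrow> real) \<Rightarrow> 'a set \<Rightarrow> 'a \<Rightarrow> bool" where
  "exact_at f \<phi> A x \<longleftrightarrow> (\<exists>l\<ge>0. local_min_on (penalty f \<phi> l) A x)"

(* The bound is a real number: every ereal-valued function is trivially bounded below by -\<infinity>. *)
definition really_bounded_below_on :: "('a \<Rightarrow> ereal) \<Rightarrow> 'a set \<Rightarrow> bool" where
  "really_bounded_below_on g S \<longleftrightarrow> (\<exists>c::real. \<forall>x\<in>S. ereal c \<le> g x)"

end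

theory Submission
  imports Defs
begin

text \<open>For sufficiency it is enough that \<open>F\<^sub>\<lambda> \<ge> f\<^sup>*\<close> on \<open>A\<close> for some \<open>\<lambda>\<close>: every larger parameter then
  penalises infeasible points strictly. Otherwise choose \<open>x\<^sub>n \<in> A\<close> with \<open>F\<^sub>n(x\<^sub>n) < f\<^sup>*\<close>.
  Boundedness below forces \<open>\<phi>(x\<^sub>n) \<rightarrow> 0\<close>, either boundedness condition then makes \<open>(x\<^sub>n)\<close>
  bounded, and semicontinuity makes each cluster point a globally optimal solution, where
  \<open>F\<^sub>n(x\<^sub>n) < f\<^sup>*\<close> contradicts exactness.\<close>

section \<open>Bolzano-Weierstrass in the span of a finite set\<close>

lemma bounded_coefficient:
  fixes b :: "'a::real_normed_vector"
  assumes "closed S" "subspace S" "b \<notin> S"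
  obtains d where "d > 0" "\<And>k y. y \<in> S \<Longrightarrow> \<bar>k\<bar> * d \<le> norm (k *\<^sub>R b + y)"
proof -
  \<comment> \<open>\<open>d\<close> is the radius of a ball around \<open>b\<close> that misses the
    closed set \<open>S\<close>.\<close>
  obtain d where d: "d > 0" "\<And>z. z \<in> S \<Longrightarrow> d \<le> dist b z"
  proof -
    have "open (- S)" "b \<in> - S"
      using assms by auto
    then obtain e where "e > 0" "ball b e \<subseteq> - S"
      using open_contains_ball by meson
    then show thesis
      by (intro that[of e]) (auto simp: subset_iff not_less[symmetric])
  qed
  have "\<bar>k\<bar> * d \<le> norm (k *\<^sub>R b + y)" if y: "y \<in> S" for k y
  proof (cases "k = 0")
    case False
    \<comment> \<open>Dividing by \<open>k\<close> turns the claim into a lower bound for the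
      distance from \<open>b\<close> to this point of \<open>S\<close>; multiplying back by
      \<bar>k\<bar> scales the bound.\<close>
    have "(- (1 / k)) *\<^sub>R y \<in> S"
      using y assms(2) by (simp add: subspace_scale subspace_neg)
    then have "d \<le> norm (b + (1 / k) *\<^sub>R y)"
      using d(2)[of "(- (1 / k)) *\<^sub>R y"] by (simp add: dist_norm)
    then have "\<bar>k\<bar> * d \<le> norm (k *\<^sub>R (b + (1 / k) *\<^sub>R y))"
      by (simp add: mult_left_mono)
    also have "k *\<^sub>R (b + (1 / k) *\<^sub>R y) = k *\<^sub>R b + y"
      using False by (simp add: scaleR_add_right)
    finally show ?thesis .
  qed auto
  with d(1) show thesis using that by blast
qed

text \<open>Induction on \<open>B\<close>: if the new vector \<open>b\<close> lies outside
  \<open>span B\<close>, write each term as \<open>k n\<close> times \<open>b\<close> plus a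
  remainder in \<open>span B\<close>. The coefficients are bounded reals and the remainders are
  bounded, so two successive extractions make both converge. This supplies the compactness for the
  sufficiency proof, where finite dimension is a hypothesis on the space and not a type
  class.\<close>

lemma finite_span_bounded_imp_convergent_subsequence:
  fixes x :: "nat \<Rightarrow> 'a::real_normed_vector"
  assumes "finite B" "range x \<subseteq> span B" "bounded (range x)"
  obtains l r where "l \<in> span B" "strict_mono r" "(x \<circ> r) \<longlonglongrightarrow> l"
proof -
  have "\<exists>l r. l \<in> span B \<and> strict_mono r \<and> (x \<circ> r) \<longlonglongrightarrow> l"
    using assms
  proof (induction B arbitrary: x rule: finite_induct)
    case empty
    then have "x = (\<lambda>_. 0)"
      by auto
    then show ?case
      by (auto intro!: exI[of _ id] simp: strict_mono_id comp_def)
  next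
    case (insert b B)
    show ?case
    proof (cases "b \<in> span B")
      case True
      then have "span (insert b B) = span B"
        by (rule span_redundant)
      with insert show ?thesis
        by auto
    next
      case False
      \<comment> \<open>The induction hypothesis itself gives closedness: a convergent sequence is
        bounded, so some subsequence converges inside \<open>span B\<close>, and limits are
        unique.\<close>
      have "closed (span B)"
        unfolding closed_sequential_limits
      proof (intro allI impI)
        fix y l assume y: "(\<forall>n. y n \<in> span B) \<and> y \<longlonglongrightarrow> l"
        then have "bounded (range y)"
          using convergent_imp_bounded by blast
        with insert.IH[of y] y obtain l' r where "l' \<in> span B" "strict_mono r" "(y \<circ> r) \<longlonglongrightarrow> l'"
          by blast
        then show "l \<in> span B"
          using y LIMSEQ_subseq_LIMSEQ LIMSEQ_unique by metis
      qed
      then obtain d where d: "d > 0"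
        and dle: "\<And>k y. y \<in> span B \<Longrightarrow> \<bar>k\<bar> * d \<le> norm (k *\<^sub>R b + y)"
        using bounded_coefficient False subspace_span by blast
      have "\<forall>n. \<exists>k. x n - k *\<^sub>R b \<in> span B"
        using insert.prems(1) by (auto simp: span_insert)
      then obtain k where k: "\<And>n. x n - k n *\<^sub>R b \<in> span B"
        by metis
      obtain C where C: "\<And>n. norm (x n) \<le> C"
        using insert.prems(2) by (auto simp: bounded_iff)
      \<comment> \<open>Apply \<open>dle\<close> with the remainder as \<open>y\<close>: the vector
        in the norm is then \<open>x n\<close> itself.\<close>
      have "\<bar>k n\<bar> \<le> C / d" for n
        using dle[OF k, of "k n" n] C[of n] d by (simp add: pos_le_divide_eq)
      then have "bounded (range k)"
        by (auto simp: bounded_iff)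
      then obtain k0 r where r: "strict_mono r" "(k \<circ> r) \<longlonglongrightarrow> k0"
        using bounded_imp_convergent_subsequence by blast
      define y where "y = (\<lambda>n. x (r n) - k (r n) *\<^sub>R b)"
      have "norm (y n) \<le> C + C / d * norm b" for n
        unfolding y_def using C[of "r n"] \<open>\<And>n. \<bar>k n\<bar> \<le> C / d\<close>[of "r n"]
        by (intro order_trans[OF norm_triangle_ineq4] add_mono)
        (auto intro!: mult_right_mono simp del: times_divide_eq_left)
      then have "bounded (range y)"
        by (auto simp: bounded_iff)
      moreover have "range y \<subseteq> span B"
        using k by (auto simp: y_def)
      ultimately obtain l s where s: "l \<in> span B" "strict_mono s" "(y \<circ> s) \<longlonglongrightarrow> l"
        using insert.IH by blast
      have "(\<lambda>n. (k \<circ> r \<circ> s) n *\<^sub>R b + (y \<circ> s) n) \<longlonglongrightarrow> k0 *\<^sub>R b + l"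
        by (intro tendsto_intros s LIMSEQ_subseq_LIMSEQ[OF r(2)])
      then have "(x \<circ> (r \<circ> s)) \<longlonglongrightarrow> k0 *\<^sub>R b + l"
        by (simp add: y_def comp_def)
      moreover have "k0 *\<^sub>R b + l \<in> span (insert b B)"
        using s(1) by (auto simp: span_insert intro!: exI[of _ k0])
      ultimately show ?thesis
        using strict_mono_o[OF r(1) s(2)] by blast
    qed
  qed
  then show thesis using that by blast
qed

section \<open>Semicontinuity and local minimality along sequences\<close>

lemma lsc_at_within_eventually:
  assumes "lsc_at_within g x S" "y < g x" "X \<longlonglongrightarrow> x" "\<And>n. X n \<in> S"
  shows "\<forall>\<^sub>F n in sequentially. y < g (X n)"
proof -
  obtain U where "open U" "x \<in> U" "\<And>z. z \<in> U \<Longrightarrow> z \<noteq> x \<Longrightarrow> z \<in> S \<Longrightarrow> y < g z"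
    using assms(1,2) unfolding lsc_at_within_def eventually_at_topological by metis
  moreover from this have "\<forall>\<^sub>F n in sequentially. X n \<in> U"
    using assms(3) topological_tendstoD by blast
  \<comment> \<open>The neighbourhood \<open>U\<close> only controls points other than
    \<open>x\<close>; terms of the sequence equal to \<open>x\<close> are covered by
    \<open>y < g x\<close>.\<close>
  ultimately show ?thesis
    using assms(2,4) by (auto elim!: eventually_mono)
qed

lemma local_min_on_eventually:
  assumes "local_min_on g S x" "X \<longlonglongrightarrow> x" "\<And>n. X n \<in> S"
  shows "\<forall>\<^sub>F n in sequentially. g x \<le> g (X n)"
proof -
  obtain U where U: "open U" "x \<in> U" "\<And>z. z \<in> U \<Longrightarrow> z \<noteq> x \<Longrightarrow> z \<in> S \<Longrightarrow> g x \<le> g z"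
    using assms(1) unfolding local_min_on_def eventually_at_topological by metis
  then have "\<forall>\<^sub>F n in sequentially. X n \<in> U"
    using assms(2) topological_tendstoD by blast
  then show ?thesis
    using U assms(3) by (fastforce elim!: eventually_mono)
qed

section \<open>Elementary facts on minimizers and the penalty function\<close>

lemma mem_global_minimizers_iff:
  "x \<in> global_minimizers g S \<longleftrightarrow> x \<in> S \<and> (\<forall>y\<in>S. g x \<le> g y)"
  by (auto simp: global_minimizers_def is_arg_min_def not_less)

lemma penalty_mono:
  assumes "0 \<le> \<phi> x" "l \<le> l'"
  shows "penalty f \<phi> l x \<le> penalty f \<phi> l' x"
  using assms by (auto simp: penalty_def intro!: add_left_mono mult_right_mono)

lemma penalty_zero_set: "\<phi> x = 0 \<Longrightarrow> penalty f \<phi> l x = f x"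
  by (simp add: penalty_def)

lemma le_penalty: "0 \<le> \<phi> x \<Longrightarrow> 0 \<le> l \<Longrightarrow> f x \<le> penalty f \<phi> l x"
  using penalty_mono[of \<phi> x 0 l f] by (simp add: penalty_def zero_ereal_def[symmetric])

section \<open>Necessity of the two conditions\<close>

lemma globally_exact_imp_exact_at:
  assumes exact: "globally_exact f \<phi> M A" and x: "x \<in> global_minimizers f (M \<inter> A)"
  shows "exact_at f \<phi> A x"
proof -
  obtain l0 where "l0 \<ge> 0" "\<And>l. l > l0 \<Longrightarrow>
      global_minimizers (penalty f \<phi> l) A = global_minimizers f (M \<inter> A)"
    using exact unfolding globally_exact_def by blast
  \<comment> \<open>Exactness only speaks of parameters strictly above \<open>l0\<close>, hence
    \<open>l0 + 1\<close>.\<close>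
  then have "x \<in> global_minimizers (penalty f \<phi> (l0 + 1)) A"
    using x by simp
  then have "local_min_on (penalty f \<phi> (l0 + 1)) A x"
    by (auto simp: mem_global_minimizers_iff local_min_on_def eventually_at_topological)
  then show ?thesis
    using \<open>l0 \<ge> 0\<close> unfolding exact_at_def by (intro exI[of _ "l0 + 1"]) auto
qed

lemma globally_exact_imp_really_bounded_below:
  assumes exact: "globally_exact f \<phi> M A" and x: "x \<in> global_minimizers f (M \<inter> A)"
    and "f x \<noteq> -\<infinity>"
  shows "\<exists>l\<ge>0. really_bounded_below_on (penalty f \<phi> l) A"
proof -
  obtain l0 where l0: "l0 \<ge> 0" "\<And>l. l > l0 \<Longrightarrow>
      global_minimizers (penalty f \<phi> l) A = global_minimizers f (M \<inter> A)"
    using exact unfolding globally_exact_def by blast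
  then have x': "x \<in> global_minimizers (penalty f \<phi> (l0 + 1)) A"
    using x by simp
  \<comment> \<open>The minimal value of the penalty function is not -\<infinity>, so some real
    number lies below it and hence below all values on \<open>A\<close>.\<close>
  have "penalty f \<phi> (l0 + 1) x \<noteq> -\<infinity>"
    using assms(3) by (cases "f x") (auto simp: penalty_def)
  then obtain c where "ereal c \<le> penalty f \<phi> (l0 + 1) x"
    by (cases "penalty f \<phi> (l0 + 1) x") auto
  then have "really_bounded_below_on (penalty f \<phi> (l0 + 1)) A"
    using x' order_trans unfolding really_bounded_below_on_def mem_global_minimizers_iff by blast
  then show ?thesis
    using l0(1) by (intro exI[of _ "l0 + 1"]) auto
qed

section \<open>Sufficiency of the two conditions\<close>

lemma globally_exactI:
  assumes nonneg: "\<And>x. 0 \<le> \<phi> x" and x0: "x0 \<in> global_minimizers f ({x. \<phi> x = 0} \<inter> A)"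
    and finite: "\<bar>f x0\<bar> \<noteq> \<infinity>"
    and l0: "0 \<le> l0" "\<And>x. x \<in> A \<Longrightarrow> f x0 \<le> penalty f \<phi> l0 x"
  shows "globally_exact f \<phi> {x. \<phi> x = 0} A"
  unfolding globally_exact_def
proof (intro exI[of _ l0] conjI allI impI set_eqI iffI l0(1))
  fix l x assume l: "l0 < l" and x: "x \<in> global_minimizers f ({x. \<phi> x = 0} \<inter> A)"
  have "f x \<le> penalty f \<phi> l y" if "y \<in> A" for y
  proof -
    have "f x \<le> f x0"
      using x x0 by (auto simp: mem_global_minimizers_iff)
    also have "\<dots> \<le> penalty f \<phi> l0 y"
      using l0(2) that .
    also have "\<dots> \<le> penalty f \<phi> l y"
      using penalty_mono nonneg l by (metis less_imp_le)
    finally show ?thesis .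
  qed
  then show "x \<in> global_minimizers (penalty f \<phi> l) A"
    using x by (auto simp: mem_global_minimizers_iff penalty_zero_set)
next
  fix l x assume l: "l0 < l" and x: "x \<in> global_minimizers (penalty f \<phi> l) A"
  have x0': "x0 \<in> A" "\<phi> x0 = 0"
    using x0 by (auto simp: mem_global_minimizers_iff)
  have xA: "x \<in> A"
    using x by (auto simp: mem_global_minimizers_iff)
  have le: "penalty f \<phi> l x \<le> f x0"
    using x x0' by (metis mem_global_minimizers_iff penalty_zero_set)
  have "\<phi> x = 0"
  proof (rule ccontr)
    assume "\<phi> x \<noteq> 0"
    then have "l0 * \<phi> x < l * \<phi> x"
      using nonneg[of x] l by (simp add: mult_strict_right_mono)
    \<comment> \<open>The two bounds squeeze \<open>f x\<close> between finite quantities, so it can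
      be cancelled, which leaves \<open>l * \<phi> x\<close> \<le>
      \<open>l0 * \<phi> x\<close>.\<close>
    then show False
      using le l0(2)[OF xA] finite by (cases "f x"; cases "f x0") (auto simp: penalty_def)
  qed
  then show "x \<in> global_minimizers f ({x. \<phi> x = 0} \<inter> A)"
    using le x0 xA by (force simp: mem_global_minimizers_iff penalty_zero_set)
qed

text \<open>Subtracting the lower bound at \<open>l0\<close> from the upper bound at
  \<open>n\<close> eliminates \<open>f\<close> and leaves \<open>(n - l0) * \<phi> (X n)\<close>
  below the constant \<open>m - c\<close>.\<close>

lemma penalty_below_imp_tendsto_zero:
  assumes nonneg: "\<And>x. 0 \<le> \<phi> x" and c: "\<And>x. x \<in> A \<Longrightarrow> ereal c \<le> penalty f \<phi> l0 x"
    and X: "\<And>n. X n \<in> A" "\<And>n. penalty f \<phi> (real n) (X n) < ereal m"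
  shows "(\<lambda>n. \<phi> (X n)) \<longlonglongrightarrow> 0"
proof (rule tendsto_sandwich[of "\<lambda>_. 0"])
  show "\<forall>\<^sub>F n in sequentially. \<phi> (X n) \<le> (m - c) / (real n - l0)"
    using eventually_gt_at_top[of "nat \<lceil>l0\<rceil>"]
  proof eventually_elim
    case (elim n)
    then have "real n - l0 > 0"
      by linarith
    moreover have "\<phi> (X n) * (real n - l0) \<le> m - c"
      using c[OF X(1), of n] X(2)[of n]
      by (cases "f (X n)") (auto simp: penalty_def algebra_simps)
    ultimately show ?case
      by (simp add: pos_le_divide_eq)
  qed
  show "(\<lambda>n. (m - c) / (real n - l0)) \<longlonglongrightarrow> 0"
    by (intro tendsto_divide_0[OF tendsto_const] filterlim_at_top_imp_at_infinity)
      (use filterlim_tendsto_add_at_top[OF tendsto_const[of "- l0"] filterlim_real_sequentially]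
        in simp)
qed (use nonneg in auto)

lemma penalty_above_optimal_value:
  fixes f :: "'a::real_normed_vector \<Rightarrow> ereal" and B :: "'a set"
  assumes fin: "finite B" "span B = UNIV"
    and nonneg: "\<And>x. 0 \<le> \<phi> x" and "closed A" "lsc_on A \<phi>"
    and f_lsc: "\<And>x. x \<in> A \<Longrightarrow> \<phi> x = 0 \<Longrightarrow> lsc_at_within f x UNIV"
    and x0: "x0 \<in> global_minimizers f ({x. \<phi> x = 0} \<inter> A)" "f x0 = ereal m"
    and bdd: "(\<exists>\<mu>\<ge>0. bounded {x \<in> A. penalty f \<phi> \<mu> x < f x0}) \<or>
       (\<exists>\<delta>>0. bounded {x \<in> A. \<phi> x < \<delta>})"
    and exact: "\<And>x. x \<in> global_minimizers f ({x. \<phi> x = 0} \<inter> A) \<Longrightarrow> exact_at f \<phi> A x"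
    and below: "really_bounded_below_on (penalty f \<phi> l0) A"
  obtains l where "0 \<le> l" "\<And>x. x \<in> A \<Longrightarrow> f x0 \<le> penalty f \<phi> l x"
proof (rule ccontr)
  assume "\<not> thesis"
  then have "\<forall>n. \<exists>x\<in>A. penalty f \<phi> (real n) x < f x0"
    using that by (metis not_less of_nat_0_le_iff)
  then obtain X where X: "\<And>n. X n \<in> A" "\<And>n. penalty f \<phi> (real n) (X n) < f x0"
    by metis
  have X_le: "penalty f \<phi> l (X n) < f x0" if "l \<le> real n" for l n
    using penalty_mono[of \<phi>, OF nonneg that] X(2) le_less_trans by blast
  obtain c where c: "\<And>x. x \<in> A \<Longrightarrow> ereal c \<le> penalty f \<phi> l0 x"
    using below unfolding really_bounded_below_on_def by blast
  have tendsto: "(\<lambda>n. \<phi> (X n)) \<longlonglongrightarrow> 0"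
    by (rule penalty_below_imp_tendsto_zero[of \<phi> A c f l0 X m])
      (use nonneg c X x0(2) in auto)
  \<comment> \<open>Each alternative captures a tail of the sequence: the sublevel set of
    \<open>\<mu>\<close> as soon as \<open>n\<close> \<ge> \<open>\<mu>\<close>, by monotonicity in
    the parameter, and the set \<open>\<phi> x < \<delta>\<close> because
    \<open>\<phi> (X n)\<close> tends to 0.\<close>
  have "\<exists>S. bounded S \<and> (\<forall>\<^sub>F n in sequentially. X n \<in> S)"
    using bdd
  proof (elim disjE exE conjE)
    fix \<mu> :: real assume b: "bounded {x \<in> A. penalty f \<phi> \<mu> x < f x0}"
    have "\<forall>\<^sub>F n in sequentially. \<mu> \<le> real n"
      using filterlim_real_sequentially by (simp add: filterlim_at_top)
    then have "\<forall>\<^sub>F n in sequentially. X n \<in> {x \<in> A. penalty f \<phi> \<mu> x < f x0}"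
      by eventually_elim (use X(1) X_le in auto)
    with b show ?thesis by blast
  next
    fix \<delta> :: real assume b: "\<delta> > 0" "bounded {x \<in> A. \<phi> x < \<delta>}"
    have "\<forall>\<^sub>F n in sequentially. X n \<in> {x \<in> A. \<phi> x < \<delta>}"
      using order_tendstoD(2)[OF tendsto b(1)] by eventually_elim (use X(1) in auto)
    with b show ?thesis by blast
  qed
  then obtain S N where S: "bounded S" "\<And>n. n \<ge> N \<Longrightarrow> X n \<in> S"
    by (auto simp: eventually_sequentially)
  \<comment> \<open>Shifting by \<open>N\<close> puts the whole sequence into \<open>S\<close>;
    adding \<open>N\<close> back to the extracted indices gives a subsequence \<open>s\<close> of
    \<open>X\<close>.\<close>
  have "bounded (range (\<lambda>n. X (n + N)))"
    using S by (auto intro: bounded_subset)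
  then obtain x r where r: "strict_mono r" "((\<lambda>n. X (n + N)) \<circ> r) \<longlonglongrightarrow> x"
    using finite_span_bounded_imp_convergent_subsequence[OF fin(1), of "\<lambda>n. X (n + N)"]
    unfolding fin(2) by blast
  define s where "s = (\<lambda>n. r n + N)"
  have s: "strict_mono s" "(X \<circ> s) \<longlonglongrightarrow> x"
    using r by (auto simp: s_def strict_mono_def comp_def)
  have XsA: "\<And>n. (X \<circ> s) n \<in> A"
    using X(1) by simp
  then have xA: "x \<in> A"
    using \<open>closed A\<close> s(2) closed_sequentially by blast
  have \<phi>x: "\<phi> x = 0"
  proof (rule ccontr)
    assume "\<phi> x \<noteq> 0"
    \<comment> \<open>Half of \<open>\<phi> x\<close> separates two incompatible facts:
      semicontinuity keeps \<open>\<phi>\<close> above it along the subsequence, while convergence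
      to 0 pushes \<open>\<phi>\<close> below it.\<close>
    then have pos: "\<phi> x / 2 < \<phi> x" "0 < \<phi> x / 2"
      using nonneg[of x] by auto
    have "\<forall>\<^sub>F n in sequentially. \<phi> x / 2 < \<phi> ((X \<circ> s) n)"
      using lsc_at_within_eventually[of \<phi> x A, OF _ pos(1) s(2) XsA] \<open>lsc_on A \<phi>\<close> xA
      unfolding lsc_on_def by blast
    moreover have "\<forall>\<^sub>F n in sequentially. \<phi> ((X \<circ> s) n) < \<phi> x / 2"
      using order_tendstoD(2)[OF LIMSEQ_subseq_LIMSEQ[OF tendsto s(1)] pos(2)] by simp
    ultimately have "\<forall>\<^sub>F n in sequentially. False"
      by eventually_elim simp
    then show False by simp
  qed
  \<comment> \<open>Along the sequence \<open>f\<close> lies below the penalty function and so below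
    \<open>f x0\<close>. The points need not be feasible, which is why semicontinuity on the whole
    space is used here.\<close>
  have "f x \<le> f x0"
  proof (rule ccontr)
    assume "\<not> f x \<le> f x0"
    then have "\<forall>\<^sub>F n in sequentially. f x0 < f ((X \<circ> s) n)"
      using lsc_at_within_eventually[of f x UNIV, OF f_lsc[OF xA \<phi>x] _ s(2)] by simp
    then obtain n where "f x0 < f (X (s n))"
      by (auto simp: eventually_sequentially)
    then show False
      using le_penalty[of \<phi>, OF nonneg, of "real (s n)" f "X (s n)"] X(2)[of "s n"] by simp
  qed
  then have x: "x \<in> global_minimizers f ({x. \<phi> x = 0} \<inter> A)" "f x = f x0"
    using x0(1) xA \<phi>x by (force simp: mem_global_minimizers_iff)+
  \<comment> \<open>Exactness at the cluster point bounds the penalty function for this fixed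
    \<open>l\<close> from below by \<open>f x0\<close> along the subsequence. Once the index
    \<open>s n\<close> exceeds \<open>l\<close>, \<open>X_le\<close> gives the opposite strict
    inequality.\<close>
  then obtain l where "local_min_on (penalty f \<phi> l) A x"
    using exact unfolding exact_at_def by blast
  then have "\<forall>\<^sub>F n in sequentially. f x0 \<le> penalty f \<phi> l ((X \<circ> s) n)"
    using local_min_on_eventually[of "penalty f \<phi> l" A x, OF _ s(2) XsA] unfolding x(2)[symmetric]
    by (subst penalty_zero_set[of \<phi>, OF \<phi>x, of f l, symmetric]) blast
  moreover have "\<forall>\<^sub>F n in sequentially. l \<le> real (s n)"
    using filterlim_compose[OF filterlim_real_sequentially filterlim_subseq[OF s(1)]]
    by (simp add: filterlim_at_top)
  ultimately have "\<forall>\<^sub>F n in sequentially. False"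
    by eventually_elim (metis X_le comp_apply leD)
  then show False by simp
qed

theorem theorem3p17:
  fixes f :: "'a::real_normed_vector \<Rightarrow> ereal"
    and \<phi> :: "'a \<Rightarrow> real"
    and M A \<Omega> :: "'a set"
    and fstar :: ereal
  assumes fin_dim: "\<exists>B. finite_dimensional_vector_space ((*\<^sub>R) :: real \<Rightarrow> 'a \<Rightarrow> 'a) B"
    and nonempty: "M \<noteq> {}" "A \<noteq> {}"
    and f_proper: "\<And>x. f x \<noteq> -\<infinity>"
    and \<phi>_nonneg: "\<And>x. 0 \<le> \<phi> x"
    and M_eq: "M = {x. \<phi> x = 0}"
    and \<Omega>_eq: "\<Omega> = M \<inter> A"
    and fstar_eq: "fstar = (INF x\<in>\<Omega>. f x)"
    and f_finite: "\<exists>x\<in>\<Omega>. f x < \<infinity>"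
    and f_attains: "global_minimizers f \<Omega> \<noteq> {}"
    and A_closed: "closed A"
    and \<phi>_lsc: "lsc_on A \<phi>"
    and f_lsc: "\<And>x. x \<in> \<Omega> \<Longrightarrow> lsc_at_within f x UNIV"
    and bounded_sublevel:
      "(\<exists>\<mu>\<ge>0. bounded {x \<in> A. penalty f \<phi> \<mu> x < fstar}) \<or>
       (\<exists>\<delta>>0. bounded {x \<in> A. \<phi> x < \<delta>})"
  shows "globally_exact f \<phi> M A \<longleftrightarrow>
     (\<forall>x \<in> global_minimizers f \<Omega>. exact_at f \<phi> A x) \<and>
     (\<exists>l0\<ge>0. really_bounded_below_on (penalty f \<phi> l0) A)"
proof
  obtain x0 where x0: "x0 \<in> global_minimizers f \<Omega>"
    using f_attains by blast
  then have min: "x0 \<in> \<Omega>" "\<And>x. x \<in> \<Omega> \<Longrightarrow> f x0 \<le> f x"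
    by (auto simp: mem_global_minimizers_iff)
  \<comment> \<open>The infimum is attained, so the optimal value can be replaced by
    \<open>f x0\<close>, which properness and \<open>f_finite\<close> then show to be real.\<close>
  then have fstar: "fstar = f x0"
    unfolding fstar_eq by (intro antisym INF_greatest INF_lower) auto
  have "f x0 \<noteq> \<infinity>"
    using f_finite min(2) by force
  then obtain m where m: "f x0 = ereal m"
    using f_proper by (cases "f x0") auto
  {
    assume "globally_exact f \<phi> M A"
    then show "(\<forall>x \<in> global_minimizers f \<Omega>. exact_at f \<phi> A x) \<and>
      (\<exists>l0\<ge>0. really_bounded_below_on (penalty f \<phi> l0) A)"
      using globally_exact_imp_exact_at globally_exact_imp_really_bounded_below x0 f_proper
      unfolding \<Omega>_eq by metis
  next
    assume exact: "(\<forall>x \<in> global_minimizers f \<Omega>. exact_at f \<phi> A x) \<and>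
      (\<exists>l0\<ge>0. really_bounded_below_on (penalty f \<phi> l0) A)"
    then obtain l0 where below: "really_bounded_below_on (penalty f \<phi> l0) A"
      by blast
    \<comment> \<open>The basis in the finite-dimensionality hypothesis serves as the finite
      spanning set for the compactness argument.\<close>
    obtain B :: "'a set" where "finite B" "span B = UNIV"
    proof -
      obtain B where "finite_dimensional_vector_space ((*\<^sub>R) :: real \<Rightarrow> 'a \<Rightarrow> 'a) B"
        using fin_dim by blast
      then show thesis
        using that finite_dimensional_vector_space.finite_Basis
          finite_dimensional_vector_space.span_Basis span_raw_def by metis
    qed
    then obtain l where "0 \<le> l" "\<And>x. x \<in> A \<Longrightarrow> f x0 \<le> penalty f \<phi> l x"
      by (rule penalty_above_optimal_value[OF _ _ \<phi>_nonneg A_closed \<phi>_lsc _ _ m _ _ below])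
        (use f_lsc x0 bounded_sublevel exact in \<open>auto simp: \<Omega>_eq M_eq fstar\<close>)
    then show "globally_exact f \<phi> M A"
      using globally_exactI[of \<phi>, OF \<phi>_nonneg] x0 m unfolding M_eq \<Omega>_eq by auto
  }
qed

end
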